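(* Let $N\in\mathbb{N}$, let $\gamma_n$ ($-N+1\le n\le N$) be real with $\gamma_n=-\gamma_{1-n}$, and let $J=H+iG$ be the $2N\times2N$ matrix with entries $H_{nm}=\delta_{n,m+1}+\delta_{n,m-1}$ and $G_{nm}=\gamma_n\delta_{n,m}$, $-N+1\le n,m\le N$. Define $\Gamma:=\max_{1\le n\le N}|\gamma_n|$. If $$\Gamma\le\frac{1}{2N}\sin^2\left(\frac{\pi}{2(2N+1)}\right),$$ then all eigenvalues of the matrix $J$ are real.
   Context: $\delta_{n,m}$ is the Kronecker symbol; rows and columns are indexed by integers from $-N+1$ to $N$. *)

theory Defs
  imports Complex_Main "Jordan_Normal_Form.Char_Poly"
begin

definition kronecker :: "int \<Rightarrow> int \<Rightarrow> complex" where
  "kronecker n m = (if n = m then 1 else 0)"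

text \<open>
  The 2N x 2N matrix whose rows and columns are labelled by the integers from -N+1 to N:
  the entry labelled (n, m) is stored at the zero-based position (n + N - 1, m + N - 1).
\<close>

definition labelled_mat :: "nat \<Rightarrow> (int \<Rightarrow> int \<Rightarrow> complex) \<Rightarrow> complex mat" where
  "labelled_mat N a =
     mat (2 * N) (2 * N) (\<lambda>(i, j). a (int i - int N + 1) (int j - int N + 1))"

definition H_mat :: "nat \<Rightarrow> complex mat" where
  "H_mat N = labelled_mat N (\<lambda>n m. kronecker n (m + 1) + kronecker n (m - 1))"

definition G_mat :: "nat \<Rightarrow> (int \<Rightarrow> real) \<Rightarrow> complex mat" where
  "G_mat N \<gamma> = labelled_mat N (\<lambda>n m. complex_of_real (\<gamma> n) * kronecker n m)"

definition J_mat :: "nat \<Rightarrow> (int \<Rightarrow> real) \<Rightarrow> complex mat" where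
  "J_mat N \<gamma> = H_mat N + \<i> \<cdot>\<^sub>m G_mat N \<gamma>"

definition Gamma_max :: "nat \<Rightarrow> (int \<Rightarrow> real) \<Rightarrow> real" where
  "Gamma_max N \<gamma> = Max ((\<lambda>n. \<bar>\<gamma> n\<bar>) ` {1..int N})"

end

theory Submission
  imports Defs
begin

text \<open>
  Let \<open>P\<close> be the reflection \<open>n \<mapsto> 1 - n\<close>. If \<open>v\<close> is an eigenvector of \<open>J\<close> for \<open>z\<close>, then the
  conjugate of \<open>P v\<close> is one for the conjugate of \<open>z\<close>; as \<open>J\<close> is symmetric, a non-real \<open>z\<close> forces
  \<open>\<langle>P v, v\<rangle> = 0\<close>. The discrete sine transform diagonalises \<open>H\<close>, with eigenvalues
  \<open>2 cos (k\<pi>/(2N+1))\<close>, and turns \<open>P\<close> into multiplication by \<open>\<plusminus>1\<close> according to the parity of \<open>k\<close>.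
  Hence the even and the odd modes of \<open>v\<close> carry the same mass. All modes of one of the two
  parities have eigenvalues at distance at least half the spectral gap from \<open>z\<close>, which
  contradicts \<open>\<parallel>(z - H) v\<parallel> = \<parallel>G v\<parallel> \<le> \<Gamma> \<parallel>v\<parallel>\<close>.
\<close>

section \<open>Sine modes of the discrete path and their orthogonality\<close>

text \<open>Multiplication by \<open>2 * sin (a / 2)\<close>, where \<open>a\<close> is the angular
  step, makes the sum telescope. The bounds on \<open>n\<close> place \<open>a / 2\<close> strictly
  between 0 and pi, so this factor can be cancelled.\<close>

lemma sum_cos_multiples:
  assumes "0 < n" "n < 2 * M"
  shows "(\<Sum>k<M. cos (real n * real k * pi / real M)) = (1 - (-1) ^ n) / 2"
proof -
  define a where "a = real n * pi / real M"
  have M: "real M > 0" using assms by simp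
  have pos: "sin (a / 2) > 0"
  proof (rule sin_gt_zero)
    show "0 < a / 2" using assms M by (simp add: a_def)
    have "real n < 2 * real M" using assms by linarith
    then show "a / 2 < pi" using M by (simp add: a_def field_simps)
  qed
  have "2 * sin (a / 2) * (\<Sum>k<M. cos (real k * a))
      = (\<Sum>k<M. sin (real (Suc k) * a - a / 2) - sin (real k * a - a / 2))"
    unfolding sum_distrib_left
  proof (rule sum.cong[OF refl])
    fix k
    have e: "real (Suc k) * a - a / 2 = real k * a + a / 2" by (simp add: algebra_simps)
    show "2 * sin (a / 2) * cos (real k * a)
        = sin (real (Suc k) * a - a / 2) - sin (real k * a - a / 2)"
      unfolding e by (simp add: sin_add sin_diff)
  qed
  also have "\<dots> = sin (real M * a - a / 2) + sin (a / 2)"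
    by (subst sum_lessThan_telescope) simp
  also have "real M * a = real n * pi" using M by (simp add: a_def)
  also have "sin (real n * pi - a / 2) + sin (a / 2) = sin (a / 2) * (1 - (-1) ^ n)"
    by (simp add: sin_diff algebra_simps)
  finally have "(\<Sum>k<M. cos (real k * a)) = (1 - (-1) ^ n) / 2"
    using pos by (simp only: mult.assoc mult.left_commute[of 2] mult_left_cancel) simp
  then show ?thesis by (simp add: a_def mult_ac)
qed

text \<open>Eigenvectors of the path with Dirichlet boundary at 0 and \<open>M\<close>:
  \<open>k\<close> numbers the mode and \<open>j\<close> the site. The formula is symmetric in
  \<open>j\<close> and \<open>k\<close>.\<close>

definition sine_mode :: "nat \<Rightarrow> nat \<Rightarrow> nat \<Rightarrow> real" where
  "sine_mode M k j = sin (real j * real k * pi / real M)"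

lemma sine_mode_0 [simp]: "sine_mode M k 0 = 0"
  by (simp add: sine_mode_def)

lemma sine_mode_end [simp]: "sine_mode M k M = 0"
  by (cases "M = 0") (simp_all add: sine_mode_def)

lemma sine_mode_recurrence:
  assumes "j \<ge> 1"
  shows "sine_mode M k (j - 1) + sine_mode M k (j + 1)
    = 2 * cos (real k * pi / real M) * sine_mode M k j"
proof -
  have e: "real (j - 1) * real k * pi / real M
        = real j * real k * pi / real M - real k * pi / real M"
      "real (j + 1) * real k * pi / real M
        = real j * real k * pi / real M + real k * pi / real M"
    using assms by (simp_all add: of_nat_diff algebra_simps diff_divide_distrib add_divide_distrib)
  show ?thesis unfolding sine_mode_def e by (simp add: sin_add sin_diff)
qed

text \<open>Since sin (k pi - t) = - (-1)^k sin t, modes with odd \<open>k\<close> are symmetric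
  under reflection and modes with even \<open>k\<close> antisymmetric.\<close>

lemma sine_mode_reflect:
  assumes "j \<le> M" "M \<ge> 1"
  shows "sine_mode M k (M - j) = - ((-1) ^ k) * sine_mode M k j"
proof -
  have "real (M - j) * real k * pi / real M = real k * pi - real j * real k * pi / real M"
    using assms by (simp add: of_nat_diff field_simps)
  then show ?thesis by (simp add: sine_mode_def sin_diff)
qed

text \<open>The sum runs over modes rather than sites, the form that Parseval requires. The product
  formula reduces it to two cosine sums; \<open>j - l\<close> and \<open>j + l\<close> have the same
  parity, so these cancel unless \<open>j = l\<close>, when the first one degenerates to
  \<open>M\<close>.\<close>

lemma sine_mode_orthogonal:
  assumes "j \<in> {1..<M}" "l \<in> {1..<M}"
  shows "(\<Sum>k=1..<M. sine_mode M k j * sine_mode M k l) = (if j = l then real M / 2 else 0)"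
proof -
  have *: "(\<Sum>k=1..<M. sine_mode M k j * sine_mode M k l) = (if j = l then real M / 2 else 0)"
    if "l \<le> j" "j \<in> {1..<M}" "l \<in> {1..<M}" for j l
  proof -
    have "(\<Sum>k=1..<M. sine_mode M k j * sine_mode M k l)
        = (\<Sum>k<M. sine_mode M k j * sine_mode M k l)"
      by (rule sum.mono_neutral_left) (auto simp: sine_mode_def Suc_le_eq)
    also have "\<dots> = (\<Sum>k<M. (cos (real (j - l) * real k * pi / real M)
        - cos (real (j + l) * real k * pi / real M)) / 2)"
    proof (rule sum.cong[OF refl])
      fix k
      have e: "real (j - l) * real k * pi / real M
          = real j * real k * pi / real M - real l * real k * pi / real M"
        "real (j + l) * real k * pi / real M
          = real j * real k * pi / real M + real l * real k * pi / real M"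
        using that
        by (simp_all add: of_nat_diff algebra_simps diff_divide_distrib add_divide_distrib)
      show "sine_mode M k j * sine_mode M k l = (cos (real (j - l) * real k * pi / real M)
          - cos (real (j + l) * real k * pi / real M)) / 2"
        unfolding e sine_mode_def by (simp add: cos_add cos_diff)
    qed
    also have "\<dots> = ((\<Sum>k<M. cos (real (j - l) * real k * pi / real M))
        - (\<Sum>k<M. cos (real (j + l) * real k * pi / real M))) / 2"
      by (simp add: sum_subtractf sum_divide_distrib[symmetric])
    also have "(\<Sum>k<M. cos (real (j + l) * real k * pi / real M)) = (1 - (-1) ^ (j + l)) / 2"
      using that by (intro sum_cos_multiples) auto
    also have "(\<Sum>k<M. cos (real (j - l) * real k * pi / real M))
        = (if j = l then real M else (1 - (-1) ^ (j - l)) / 2)"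
    proof (cases "j = l")
      case False
      then show ?thesis using that by (simp only: if_False) (intro sum_cos_multiples, auto)
    qed simp
    also have "(-1 :: real) ^ (j - l) = (-1) ^ (j + l)"
      using that by (simp add: minus_one_power_iff)
    finally show ?thesis by (auto simp: minus_one_power_iff)
  qed
  show ?thesis
  proof (cases "l \<le> j")
    case True
    then show ?thesis using * assms by blast
  next
    case False
    then show ?thesis using *[of j l] assms by (simp add: mult.commute)
  qed
qed

section \<open>The discrete sine transform\<close>

text \<open>Left unnormalised, hence the factor \<open>M / 2\<close> in Parseval; only the interior
  sites are read.\<close>

definition sine_transform :: "nat \<Rightarrow> (nat \<Rightarrow> complex) \<Rightarrow> nat \<Rightarrow> complex" where
  "sine_transform M v k = (\<Sum>j=1..<M. of_real (sine_mode M k j) * v j)"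

lemma sine_transform_parseval:
  "(\<Sum>k=1..<M. sine_transform M v k * cnj (sine_transform M w k))
    = of_real (real M / 2) * (\<Sum>j=1..<M. v j * cnj (w j))"
proof -
  have "(\<Sum>k=1..<M. sine_transform M v k * cnj (sine_transform M w k))
      = (\<Sum>k=1..<M. \<Sum>j=1..<M. \<Sum>l=1..<M.
          of_real (sine_mode M k j * sine_mode M k l) * (v j * cnj (w l)))"
    by (simp add: sine_transform_def sum_product mult_ac)
  also have "\<dots> = (\<Sum>j=1..<M. \<Sum>l=1..<M. \<Sum>k=1..<M.
          of_real (sine_mode M k j * sine_mode M k l) * (v j * cnj (w l)))"
    by (rule trans[OF sum.swap]) (rule sum.cong[OF refl], rule sum.swap)
  also have "\<dots> = (\<Sum>j=1..<M. \<Sum>l=1..<M.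
          of_real (\<Sum>k=1..<M. sine_mode M k j * sine_mode M k l) * (v j * cnj (w l)))"
    by (simp add: sum_distrib_right)
  also have "\<dots> = (\<Sum>j=1..<M. \<Sum>l=1..<M.
          if j = l then of_real (real M / 2) * (v j * cnj (w j)) else 0)"
    by (intro sum.cong refl) (simp only: sine_mode_orthogonal, simp)
  also have "\<dots> = (\<Sum>j=1..<M. of_real (real M / 2) * (v j * cnj (w j)))"
    by (intro sum.cong refl) simp
  finally show ?thesis by (simp add: sum_distrib_left)
qed

lemma sine_transform_plancherel:
  "(\<Sum>k=1..<M. (cmod (sine_transform M v k))\<^sup>2) = real M / 2 * (\<Sum>j=1..<M. (cmod (v j))\<^sup>2)"
proof -
  have "complex_of_real (\<Sum>k=1..<M. (cmod (sine_transform M v k))\<^sup>2)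
      = of_real (real M / 2 * (\<Sum>j=1..<M. (cmod (v j))\<^sup>2))"
    using sine_transform_parseval[of M v v] by (simp add: complex_norm_square del: of_real_power)
  then show ?thesis by (simp only: of_real_eq_iff)
qed

lemma sum_reflect:
  fixes f :: "nat \<Rightarrow> 'a :: comm_monoid_add"
  shows "(\<Sum>j=1..<M. f (M - j)) = (\<Sum>j=1..<M. f j)"
  by (rule sum.reindex_bij_witness[of _ "\<lambda>j. M - j" "\<lambda>j. M - j"]) auto

lemma sine_transform_reflect:
  assumes "M \<ge> 1"
  shows "sine_transform M (\<lambda>j. v (M - j)) k = - ((-1) ^ k) * sine_transform M v k"
proof -
  have "sine_transform M (\<lambda>j. v (M - j)) k
      = (\<Sum>j=1..<M. of_real (sine_mode M k (M - (M - j))) * v (M - j))"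
    unfolding sine_transform_def by (intro sum.cong) auto
  also have "\<dots> = (\<Sum>j=1..<M. of_real (sine_mode M k (M - j)) * v j)"
    by (rule sum_reflect[where f = "\<lambda>j. of_real (sine_mode M k (M - j)) * v j"])
  also have "\<dots> = (\<Sum>j=1..<M. - ((-1) ^ k) * (of_real (sine_mode M k j) * v j))"
    using assms by (intro sum.cong refl) (simp add: sine_mode_reflect)
  finally show ?thesis by (simp add: sine_transform_def sum_distrib_left)
qed

text \<open>Summation by parts: the summands differ by an increment of the discrete Wronskian
  \<open>T\<close>, which vanishes at both ends by the Dirichlet conditions.\<close>

lemma sum_neighbours_symmetric:
  fixes u v :: "nat \<Rightarrow> complex"
  assumes "u 0 = 0" "v 0 = 0" "u M = 0" "v M = 0"
  shows "(\<Sum>j=1..<M. u j * (v (j - 1) + v (j + 1))) = (\<Sum>j=1..<M. (u (j - 1) + u (j + 1)) * v j)"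
proof (cases M)
  case (Suc n)
  define T where "T j = u j * v (Suc j) - u (Suc j) * v j" for j
  have "(\<Sum>j=1..<M. u j * (v (j - 1) + v (j + 1))) - (\<Sum>j=1..<M. (u (j - 1) + u (j + 1)) * v j)
      = (\<Sum>j=Suc 0..<Suc n. T j - T (j - 1))"
    unfolding sum_subtractf[symmetric] Suc
    by (intro sum.cong) (auto simp: T_def algebra_simps)
  also have "\<dots> = (\<Sum>j<n. T (Suc j) - T j)"
    by (simp only: sum.shift_bounds_Suc_ivl diff_Suc_1 atLeast0LessThan)
  also have "\<dots> = T n - T 0" by (rule sum_lessThan_telescope)
  also have "\<dots> = 0" using assms Suc by (simp add: T_def)
  finally show ?thesis by simp
qed simp

text \<open>Symmetry moves the neighbour sum from \<open>v\<close> onto the sine mode, where the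
  recurrence turns it into a scalar factor; thus the transform diagonalises
  \<open>H\<close>.\<close>

lemma sine_transform_neighbours:
  assumes "v 0 = 0" "v M = 0"
  shows "sine_transform M (\<lambda>j. v (j - 1) + v (j + 1)) k
    = of_real (2 * cos (real k * pi / real M)) * sine_transform M v k"
proof -
  have "sine_transform M (\<lambda>j. v (j - 1) + v (j + 1)) k
      = (\<Sum>j=1..<M. (of_real (sine_mode M k (j - 1)) + of_real (sine_mode M k (j + 1))) * v j)"
    unfolding sine_transform_def using assms
    by (intro sum_neighbours_symmetric[where u = "\<lambda>j. of_real (sine_mode M k j)"]) auto
  also have "\<dots> = (\<Sum>j=1..<M. of_real (2 * cos (real k * pi / real M)) * (of_real (sine_mode M k j) * v j))"
  proof (intro sum.cong refl)
    fix j assume "j \<in> {1..<M}"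
    then have "complex_of_real (sine_mode M k (j - 1) + sine_mode M k (j + 1))
        = of_real (2 * cos (real k * pi / real M) * sine_mode M k j)"
      using sine_mode_recurrence by (simp only: atLeastLessThan_iff)
    then show "(complex_of_real (sine_mode M k (j - 1)) + of_real (sine_mode M k (j + 1))) * v j
        = of_real (2 * cos (real k * pi / real M)) * (of_real (sine_mode M k j) * v j)"
      by simp
  qed
  finally show ?thesis by (simp add: sine_transform_def sum_distrib_left)
qed

section \<open>Separation of the eigenvalues 2 cos (k pi / M)\<close>

lemma sin_ge_sin_of_between:
  assumes "0 \<le> a" "a \<le> x" "x \<le> pi - a"
  shows "sin a \<le> sin x"
proof (cases "x \<le> pi / 2")
  case True
  then show ?thesis using assms pi_gt_zero by (intro sin_monotone_2pi_le) auto
next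
  case False
  then have "sin a \<le> sin (pi - x)" using assms pi_gt_zero by (intro sin_monotone_2pi_le) auto
  then show ?thesis by simp
qed

text \<open>With \<open>a = pi / (2 * M)\<close>, half the difference of the eigenvalues is 2 sin
  ((j + k) a) sin ((k - j) a) for \<open>j < k\<close>. Both angles lie between \<open>a\<close> and
  \<open>pi - a\<close>, so each sine is at least \<open>sin a\<close>.\<close>

lemma cos_spectral_gap:
  assumes "j \<in> {1..<M}" "k \<in> {1..<M}" "j \<noteq> k"
  shows "4 * (sin (pi / (2 * real M)))\<^sup>2
    \<le> \<bar>2 * cos (real j * pi / real M) - 2 * cos (real k * pi / real M)\<bar>"
proof -
  have *: "4 * (sin (pi / (2 * real M)))\<^sup>2
      \<le> 2 * cos (real j * pi / real M) - 2 * cos (real k * pi / real M)"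
    if "j \<in> {1..<M}" "k \<in> {1..<M}" "j < k" for j k
  proof -
    define a where "a = pi / (2 * real M)"
    have M: "real M > 0" using that by simp
    have a: "0 < a" "2 * real M * a = pi" using M by (simp_all add: a_def)
    have sin_le: "sin a \<le> sin (real n * a)" if "1 \<le> n" "n + 1 \<le> 2 * M" for n
    proof (rule sin_ge_sin_of_between)
      show "a \<le> real n * a" using a that by simp
      have "real n + 1 \<le> 2 * real M" using that by linarith
      then have "(real n + 1) * a \<le> 2 * real M * a" using a by (intro mult_right_mono) auto
      then show "real n * a \<le> pi - a" using a by (simp add: algebra_simps)
    qed (use a in simp)
    have sa: "0 \<le> sin a"
    proof (rule sin_ge_zero)
      have "1 * a \<le> 2 * real M * a" using a that by (intro mult_right_mono) auto
      then show "a \<le> pi" unfolding a(2) by simp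
    qed (use a in simp)
    have sums: "real (j + k) * a = real k * a + real j * a"
        "real (k - j) * a = real k * a - real j * a"
      using that by (simp_all add: of_nat_diff algebra_simps)
    have product: "sin (x + y) * sin (x - y) = (cos (2 * y) - cos (2 * x)) / 2" for x y :: real
      by (simp add: sin_times_sin)
    have angles: "real j * pi / real M = 2 * (real j * a)"
        "real k * pi / real M = 2 * (real k * a)"
      by (simp_all add: a_def)
    have "sin a * sin a \<le> sin (real (j + k) * a) * sin (real (k - j) * a)"
      using sa that by (intro mult_mono sin_le order_trans[OF sa]) auto
    also have "\<dots> = (cos (2 * (real j * a)) - cos (2 * (real k * a))) / 2"
      unfolding sums by (rule product)
    finally have "4 * (sin a * sin a) \<le> 4 * ((cos (2 * (real j * a)) - cos (2 * (real k * a))) / 2)"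
      by (rule mult_left_mono) simp
    also have "\<dots> = 2 * cos (2 * (real j * a)) - 2 * cos (2 * (real k * a))"
      by (simp only: right_diff_distrib diff_divide_distrib)
    finally show ?thesis unfolding angles power2_eq_square a_def[symmetric] .
  qed
  show ?thesis
  proof (cases "j < k")
    case True
    then show ?thesis using *[of j k] assms by linarith
  next
    case False
    then show ?thesis using *[of k j] assms by linarith
  qed
qed

section \<open>Exclusion of non-real eigenvalues on the path\<close>

text \<open>In the application \<open>f k\<close> is the mass of mode \<open>k\<close>,
  \<open>\<mu> k\<close> the distance from \<open>z\<close> to its eigenvalue and
  \<open>2 * d\<close> a lower bound for the spectral gap. The factor 2 arises because the parity
  class used for the estimate carries exactly half of the total mass.\<close>

lemma balanced_modes_residual:
  fixes f \<mu> :: "nat \<Rightarrow> real"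
  assumes "finite A" "\<And>k. k \<in> A \<Longrightarrow> f k \<ge> 0"
    and balanced: "(\<Sum>k\<in>A. (-1) ^ k * f k) = 0"
    and "\<And>k. k \<in> A \<Longrightarrow> 0 \<le> \<mu> k"
    and gap: "\<And>j k. j \<in> A \<Longrightarrow> k \<in> A \<Longrightarrow> j \<noteq> k \<Longrightarrow> 2 * d \<le> \<mu> j + \<mu> k"
    and "d \<ge> 0"
  shows "d\<^sup>2 * (\<Sum>k\<in>A. f k) \<le> 2 * (\<Sum>k\<in>A. (\<mu> k)\<^sup>2 * f k)"
proof -
  have split: "sum h A = sum h {k\<in>A. even k} + sum h {k\<in>A. odd k}" for h :: "nat \<Rightarrow> real"
    by (subst sum.union_disjoint[symmetric]) (auto simp: assms(1) intro!: sum.cong)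
  define E where "E = sum f {k\<in>A. even k}"
  have E': "sum f {k\<in>A. odd k} = E"
    using balanced unfolding split[of "\<lambda>k. (-1) ^ k * f k"] E_def by (simp add: sum_negf)
  have total: "sum f A = 2 * E" using split[of f] E' E_def by simp
  have bound: "d\<^sup>2 * sum f B \<le> (\<Sum>k\<in>A. (\<mu> k)\<^sup>2 * f k)" if "B \<subseteq> A" "\<And>k. k \<in> B \<Longrightarrow> d \<le> \<mu> k" for B
  proof -
    have "d\<^sup>2 * sum f B \<le> (\<Sum>k\<in>B. (\<mu> k)\<^sup>2 * f k)"
      unfolding sum_distrib_left using that assms
      by (intro sum_mono mult_right_mono power_mono) auto
    also have "\<dots> \<le> (\<Sum>k\<in>A. (\<mu> k)\<^sup>2 * f k)"
      using that assms by (intro sum_mono2) auto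
    finally show ?thesis .
  qed
  \<comment> \<open>At most one mode lies closer than \<open>d\<close>, so one parity class consists of distant modes only.\<close>
  have "(\<forall>k\<in>{k\<in>A. even k}. d \<le> \<mu> k) \<or> (\<forall>k\<in>{k\<in>A. odd k}. d \<le> \<mu> k)"
  proof (rule ccontr)
    assume "\<not> ?thesis"
    then obtain j k where "j \<in> A" "even j" "\<mu> j < d" "k \<in> A" "odd k" "\<mu> k < d"
      by (auto simp: not_le)
    then show False using gap[of j k] by fastforce
  qed
  then have "d\<^sup>2 * E \<le> (\<Sum>k\<in>A. (\<mu> k)\<^sup>2 * f k)"
    using bound[of "{k\<in>A. even k}"] bound[of "{k\<in>A. odd k}"] E' E_def by auto
  then show ?thesis unfolding total by linarith
qed

lemma reflected_form_vanishes:
  fixes v :: "nat \<Rightarrow> complex" and g :: "nat \<Rightarrow> real"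
  assumes bdry: "v 0 = 0" "v M = 0"
    and eq: "\<And>j. j \<in> {1..<M} \<Longrightarrow> v (j - 1) + v (j + 1) + \<i> * of_real (g j) * v j = z * v j"
    and anti: "\<And>j. j \<in> {1..<M} \<Longrightarrow> g (M - j) = - g j"
    and "z \<notin> \<real>"
  shows "(\<Sum>j=1..<M. v (M - j) * cnj (v j)) = 0"
proof -
  \<comment> \<open>Conjugation flips the sign of the imaginary unit and reflection that of
    \<open>g\<close>. The two signs cancel, so \<open>u\<close> solves the same equation with
    \<open>cnj z\<close> in place of \<open>z\<close>.\<close>
  define u where "u j = cnj (v (M - j))" for j
  have u: "u (j - 1) + u (j + 1) + \<i> * of_real (g j) * u j = cnj z * u j" if "j \<in> {1..<M}" for j
  proof -
    have j: "M - j \<in> {1..<M}" "M - (j - 1) = M - j + 1" "M - (j + 1) = M - j - 1"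
      using that by auto
    have "cnj (v (M - j - 1) + v (M - j + 1) + \<i> * of_real (g (M - j)) * v (M - j))
        = cnj (z * v (M - j))"
      using eq[OF j(1)] by simp
    then show ?thesis using anti[OF that] unfolding u_def j(2,3) by (simp add: algebra_simps)
  qed
  have "(\<Sum>j=1..<M. u j * (v (j - 1) + v (j + 1))) = (\<Sum>j=1..<M. (u (j - 1) + u (j + 1)) * v j)"
    using bdry by (intro sum_neighbours_symmetric) (auto simp: u_def)
  moreover have "(\<Sum>j=1..<M. u j * (v (j - 1) + v (j + 1)))
      = (\<Sum>j=1..<M. z * (u j * v j) - \<i> * of_real (g j) * u j * v j)"
  proof (intro sum.cong refl)
    fix j assume "j \<in> {1..<M}"
    then have "v (j - 1) + v (j + 1) = z * v j - \<i> * of_real (g j) * v j"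
      using eq[of j] by (simp add: eq_diff_eq)
    then show "u j * (v (j - 1) + v (j + 1)) = z * (u j * v j) - \<i> * of_real (g j) * u j * v j"
      by (simp only:) (simp add: algebra_simps)
  qed
  moreover have "(\<Sum>j=1..<M. (u (j - 1) + u (j + 1)) * v j)
      = (\<Sum>j=1..<M. cnj z * (u j * v j) - \<i> * of_real (g j) * u j * v j)"
  proof (intro sum.cong refl)
    fix j assume "j \<in> {1..<M}"
    then have "u (j - 1) + u (j + 1) = cnj z * u j - \<i> * of_real (g j) * u j"
      using u[of j] by (simp add: eq_diff_eq)
    then show "(u (j - 1) + u (j + 1)) * v j
        = cnj z * (u j * v j) - \<i> * of_real (g j) * u j * v j"
      by (simp only:) (simp add: algebra_simps)
  qed
  \<comment> \<open>The pairing of \<open>u\<close> and \<open>v\<close> is bilinear, without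
    conjugation, so the potential contributes equally to both sides and drops out.\<close>
  ultimately have "z * (\<Sum>j=1..<M. u j * v j) = cnj z * (\<Sum>j=1..<M. u j * v j)"
    by (simp add: sum_subtractf sum_distrib_left)
  moreover have "z \<noteq> cnj z" using \<open>z \<notin> \<real>\<close> by (metis Reals_cnj_iff)
  ultimately have "(\<Sum>j=1..<M. u j * v j) = 0" by simp
  then have "cnj (\<Sum>j=1..<M. u j * v j) = 0" by simp
  then show ?thesis by (simp add: u_def)
qed

text \<open>With \<open>s\<close> the bound on the potential, the residual of a non-real eigenvalue
  would have squared norm at least half of \<open>(2 * s)\<^sup>2\<close> times that of
  \<open>v\<close>, yet at most \<open>s\<^sup>2\<close> times it.\<close>

lemma real_spectrum_of_small_antisymmetric_potential:
  fixes v :: "nat \<Rightarrow> complex" and g :: "nat \<Rightarrow> real"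
  assumes M: "M \<ge> 2"
    and bdry: "v 0 = 0" "v M = 0"
    and eq: "\<And>j. j \<in> {1..<M} \<Longrightarrow> v (j - 1) + v (j + 1) + \<i> * of_real (g j) * v j = z * v j"
    and anti: "\<And>j. j \<in> {1..<M} \<Longrightarrow> g (M - j) = - g j"
    and small: "\<And>j. j \<in> {1..<M} \<Longrightarrow> \<bar>g j\<bar> \<le> (sin (pi / (2 * real M)))\<^sup>2"
    and nonzero: "\<exists>j\<in>{1..<M}. v j \<noteq> 0"
  shows "z \<in> \<real>"
proof (rule ccontr)
  assume z: "z \<notin> \<real>"
  define s where "s = (sin (pi / (2 * real M)))\<^sup>2"
  define c where "c = sine_transform M v"
  define \<mu> where "\<mu> k = cmod (z - of_real (2 * cos (real k * pi / real M)))" for k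
  define w where "w j = \<i> * of_real (g j) * v j" for j
  have "sin (pi / (2 * real M)) > 0"
    using M pi_gt_zero by (intro sin_gt_zero) (auto simp: field_simps intro: less_le_trans)
  then have s: "s > 0" by (simp add: s_def)
  \<comment> \<open>Here \<open>w\<close> is the potential term, which equals (z - H) v by the
    eigenvalue equation; on the transform side z - H acts by multiplication.\<close>
  have residual: "sine_transform M w k = (z - of_real (2 * cos (real k * pi / real M))) * c k" for k
  proof -
    have "sine_transform M w k = sine_transform M (\<lambda>j. z * v j - (v (j - 1) + v (j + 1))) k"
      unfolding sine_transform_def
      using eq by (intro sum.cong refl arg_cong2[where f = "(*)"]) (force simp: w_def algebra_simps)
    also have "\<dots> = z * c k - sine_transform M (\<lambda>j. v (j - 1) + v (j + 1)) k"
      unfolding c_def sine_transform_def sum_distrib_left sum_subtractf[symmetric]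
      by (intro sum.cong refl) (simp add: algebra_simps)
    also have "\<dots> = (z - of_real (2 * cos (real k * pi / real M))) * c k"
      unfolding sine_transform_neighbours[OF bdry] c_def by (simp add: algebra_simps)
    finally show ?thesis .
  qed
  \<comment> \<open>Reflection multiplies mode \<open>k\<close> by - (-1)^k, so Parseval turns the
    vanishing reflected form into equality of even and odd mass.\<close>
  have "(\<Sum>k=1..<M. of_real ((-1) ^ k * (cmod (c k))\<^sup>2))
      = - (\<Sum>k=1..<M. sine_transform M (\<lambda>j. v (M - j)) k * cnj (sine_transform M v k))"
    unfolding sum_negf[symmetric]
  proof (intro sum.cong refl)
    fix k
    have "1 \<le> M" using M by simp
    show "complex_of_real ((-1) ^ k * (cmod (c k))\<^sup>2)
        = - (sine_transform M (\<lambda>j. v (M - j)) k * cnj (sine_transform M v k))"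
      by (simp only: of_real_mult complex_norm_square sine_transform_reflect[OF \<open>1 \<le> M\<close>] c_def)
        simp
  qed
  also have "\<dots> = 0"
    unfolding sine_transform_parseval
    using reflected_form_vanishes[OF bdry eq anti z] by simp
  finally have "complex_of_real (\<Sum>k=1..<M. (-1) ^ k * (cmod (c k))\<^sup>2) = 0"
    by (simp only: of_real_sum)
  then have balanced: "(\<Sum>k=1..<M. (-1) ^ k * (cmod (c k))\<^sup>2) = 0"
    by (simp only: of_real_eq_0_iff)
  \<comment> \<open>The eigenvalues are at least \<open>4 * s\<close> apart, and the triangle
    inequality through \<open>z\<close> splits this between the two distances; hence
    \<open>d = 2 * s\<close>.\<close>
  have gap: "2 * (2 * s) \<le> \<mu> j + \<mu> k" if "j \<in> {1..<M}" "k \<in> {1..<M}" "j \<noteq> k" for j k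
  proof -
    let ?l = "\<lambda>k. complex_of_real (2 * cos (real k * pi / real M))"
    have "4 * s \<le> \<bar>2 * cos (real j * pi / real M) - 2 * cos (real k * pi / real M)\<bar>"
      using cos_spectral_gap[OF that] by (simp add: s_def)
    also have "\<dots> = cmod (?l j - ?l k)"
      by (metis norm_of_real of_real_diff real_norm_def)
    also have "?l j - ?l k = (z - ?l k) - (z - ?l j)" by simp
    also have "cmod \<dots> \<le> \<mu> k + \<mu> j" unfolding \<mu>_def by (rule norm_triangle_ineq4)
    finally show ?thesis by simp
  qed
  have pos: "(\<Sum>j=1..<M. (cmod (v j))\<^sup>2) > 0"
  proof -
    from nonzero obtain j where "j \<in> {1..<M}" "v j \<noteq> 0" by blast
    then show ?thesis by (intro sum_pos2[where i = j]) auto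
  qed
  have "(2 * s)\<^sup>2 * (\<Sum>k=1..<M. (cmod (c k))\<^sup>2) \<le> 2 * (\<Sum>k=1..<M. (\<mu> k)\<^sup>2 * (cmod (c k))\<^sup>2)"
    using gap s by (intro balanced_modes_residual balanced) (auto simp: \<mu>_def)
  also have "(\<Sum>k=1..<M. (\<mu> k)\<^sup>2 * (cmod (c k))\<^sup>2) = (\<Sum>k=1..<M. (cmod (sine_transform M w k))\<^sup>2)"
    by (simp add: residual \<mu>_def norm_mult power_mult_distrib)
  also have "\<dots> = real M / 2 * (\<Sum>j=1..<M. (cmod (w j))\<^sup>2)"
    by (rule sine_transform_plancherel)
  also have "\<dots> \<le> real M / 2 * (\<Sum>j=1..<M. s\<^sup>2 * (cmod (v j))\<^sup>2)"
  proof (intro mult_left_mono sum_mono)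
    fix j assume "j \<in> {1..<M}"
    then have "\<bar>g j\<bar>\<^sup>2 \<le> s\<^sup>2" using small by (intro power_mono) (auto simp: s_def)
    then show "(cmod (w j))\<^sup>2 \<le> s\<^sup>2 * (cmod (v j))\<^sup>2"
      by (simp add: w_def norm_mult power_mult_distrib mult_right_mono)
  qed simp
  finally have "(2 * s)\<^sup>2 * (real M / 2 * (\<Sum>j=1..<M. (cmod (v j))\<^sup>2))
      \<le> 2 * s\<^sup>2 * (real M / 2 * (\<Sum>j=1..<M. (cmod (v j))\<^sup>2))"
    unfolding c_def sine_transform_plancherel by (simp add: sum_distrib_left[symmetric] mult_ac)
  moreover have "real M / 2 * (\<Sum>j=1..<M. (cmod (v j))\<^sup>2) > 0" using pos M by simp
  ultimately have "(2 * s)\<^sup>2 \<le> 2 * s\<^sup>2" by (simp only: mult_le_cancel_right_pos)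
  then show False using s by (simp add: power_mult_distrib)
qed

section \<open>From the matrix to the difference equation on the path\<close>

lemma J_mat_entry:
  assumes "i < 2 * N" "j < 2 * N"
  shows "J_mat N \<gamma> $$ (i, j) = (if i = j + 1 then 1 else 0) + (if j = i + 1 then 1 else 0)
    + (if i = j then \<i> * of_real (\<gamma> (int i - int N + 1)) else 0)"
  using assms by (auto simp: J_mat_def H_mat_def G_mat_def labelled_mat_def kronecker_def)

text \<open>The two conditionals record the missing neighbour in the first and last row; they become
  Dirichlet values once \<open>x\<close> is padded by zeros.\<close>

lemma J_mat_mult_vec_entry:
  assumes "x \<in> carrier_vec (2 * N)" "i < 2 * N"
  shows "(J_mat N \<gamma> *\<^sub>v x) $ i = (if i = 0 then 0 else x $ (i - 1))
    + (if i + 1 < 2 * N then x $ (i + 1) else 0) + \<i> * of_real (\<gamma> (int i - int N + 1)) * x $ i"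
proof -
  have dim: "dim_row (J_mat N \<gamma>) = 2 * N" "dim_col (J_mat N \<gamma>) = 2 * N"
    by (simp_all add: J_mat_def G_mat_def labelled_mat_def)
  have "(J_mat N \<gamma> *\<^sub>v x) $ i = (\<Sum>j=0..<2 * N. J_mat N \<gamma> $$ (i, j) * x $ j)"
    using assms dim by (simp add: scalar_prod_def)
  also have "\<dots> = (\<Sum>j=0..<2 * N. (if i = j + 1 then x $ j else 0)
      + (if j = i + 1 then x $ j else 0)
      + (if i = j then \<i> * of_real (\<gamma> (int i - int N + 1)) * x $ j else 0))"
    using assms by (intro sum.cong refl) (simp add: J_mat_entry)
  also have "\<dots> = (\<Sum>j=0..<2 * N. if i = j + 1 then x $ j else 0)
      + (\<Sum>j=0..<2 * N. if j = i + 1 then x $ j else 0)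
      + (\<Sum>j=0..<2 * N. if i = j then \<i> * of_real (\<gamma> (int i - int N + 1)) * x $ j else 0)"
    by (simp add: sum.distrib)
  also have "(\<Sum>j=0..<2 * N. if i = j + 1 then x $ j else 0) = (if i = 0 then 0 else x $ (i - 1))"
    using assms(2) by (cases i) auto
  also have "(\<Sum>j=0..<2 * N. if j = i + 1 then x $ j else 0)
      = (if i + 1 < 2 * N then x $ (i + 1) else 0)"
    by simp
  also have "(\<Sum>j=0..<2 * N. if i = j then \<i> * of_real (\<gamma> (int i - int N + 1)) * x $ j else 0)
      = \<i> * of_real (\<gamma> (int i - int N + 1)) * x $ i"
    using assms(2) by simp
  finally show ?thesis .
qed

text \<open>The maximum ranges over positive labels only; antisymmetry carries the bound to the
  labels \<open>n \<le> 0\<close>.\<close>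

lemma abs_le_Gamma_max:
  assumes anti: "\<And>n. - int N + 1 \<le> n \<Longrightarrow> n \<le> int N \<Longrightarrow> \<gamma> n = - \<gamma> (1 - n)"
    and n: "- int N + 1 \<le> n" "n \<le> int N"
  shows "\<bar>\<gamma> n\<bar> \<le> Gamma_max N \<gamma>"
proof (cases "n \<ge> 1")
  case True
  then show ?thesis using n by (auto simp: Gamma_max_def intro!: Max_ge)
next
  case False
  then have "\<bar>\<gamma> (1 - n)\<bar> \<le> Gamma_max N \<gamma>" using n by (auto simp: Gamma_max_def intro!: Max_ge)
  then show ?thesis using anti[OF n] by simp
qed

theorem theorem2p1:
  fixes N :: nat and \<gamma> :: "int \<Rightarrow> real"
  assumes "N \<ge> 1"
    and "\<And>n. - int N + 1 \<le> n \<Longrightarrow> n \<le> int N \<Longrightarrow> \<gamma> n = - \<gamma> (1 - n)"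
    and "Gamma_max N \<gamma> \<le> 1 / (2 * real N) * (sin (pi / (2 * (2 * real N + 1))))\<^sup>2"
  shows "\<forall>z. eigenvalue (J_mat N \<gamma>) z \<longrightarrow> z \<in> \<real>"
proof (intro allI impI)
  fix z assume "eigenvalue (J_mat N \<gamma>) z"
  then obtain x where x: "x \<in> carrier_vec (2 * N)" "x \<noteq> 0\<^sub>v (2 * N)" "J_mat N \<gamma> *\<^sub>v x = z \<cdot>\<^sub>v x"
    by (auto simp: eigenvalue_def eigenvector_def J_mat_def G_mat_def labelled_mat_def)
  \<comment> \<open>This leaves \<open>2 * N\<close> interior sites, one for each row, and makes
    \<open>pi / (2 * M)\<close> the angle of the hypothesis.\<close>
  define M where "M = 2 * N + 1"
  \<comment> \<open>Position \<open>j\<close> carries the label \<open>n = j - N\<close>; the end points \<open>0\<close> and \<open>M\<close> are a Dirichlet boundary.\<close>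
  define v where "v j = (if j \<in> {1..<M} then x $ (j - 1) else 0)" for j
  define g where "g j = \<gamma> (int j - int N)" for j :: nat
  show "z \<in> \<real>"
  proof (rule real_spectrum_of_small_antisymmetric_potential[of M v g])
    show "M \<ge> 2" using assms(1) by (simp add: M_def)
    show "v 0 = 0" "v M = 0" by (simp_all add: v_def)
    show "v (j - 1) + v (j + 1) + \<i> * of_real (g j) * v j = z * v j" if j: "j \<in> {1..<M}" for j
    proof -
      have "(J_mat N \<gamma> *\<^sub>v x) $ (j - 1) = z * x $ (j - 1)"
        using x j by (auto simp: M_def)
      \<comment> \<open>Site \<open>j\<close> is stored at the zero-based position
        \<open>j - 1\<close>, so the shift by one in the labelling is absorbed.\<close>
      moreover have "int (j - 1) - int N + 1 = int j - int N" using j by auto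
      ultimately show ?thesis
        using J_mat_mult_vec_entry[OF x(1), of "j - 1" \<gamma>] j by (auto simp: v_def g_def M_def)
    qed
    show "g (M - j) = - g j" if "j \<in> {1..<M}" for j
    proof -
      \<comment> \<open>The site reflection \<open>j\<close> to \<open>M - j\<close> is the label
        reflection \<open>n\<close> to \<open>1 - n\<close>.\<close>
      have label: "int (M - j) - int N = 1 - (int j - int N)" using that by (auto simp: M_def)
      have "\<gamma> (int j - int N) = - \<gamma> (1 - (int j - int N))"
        using that by (intro assms(2)) (auto simp: M_def)
      then show ?thesis unfolding g_def label by linarith
    qed
    show "\<bar>g j\<bar> \<le> (sin (pi / (2 * real M)))\<^sup>2" if "j \<in> {1..<M}" for j
    proof -
      have "\<bar>g j\<bar> \<le> Gamma_max N \<gamma>"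
        unfolding g_def using that by (intro abs_le_Gamma_max assms(2)) (auto simp: M_def)
      also have "\<dots> \<le> 1 / (2 * real N) * (sin (pi / (2 * real M)))\<^sup>2"
        using assms(3) by (simp add: M_def add.commute)
      also have "\<dots> \<le> 1 * (sin (pi / (2 * real M)))\<^sup>2"
        using assms(1) by (intro mult_right_mono) auto
      finally show ?thesis by simp
    qed
    show "\<exists>j\<in>{1..<M}. v j \<noteq> 0"
    proof (rule ccontr)
      assume zero: "\<not> ?thesis"
      have "x $ i = 0" if "i < 2 * N" for i
        using zero that by (auto simp: v_def M_def dest!: bspec[of _ _ "Suc i"])
      then have "x = 0\<^sub>v (2 * N)" using x(1) by (intro eq_vecI) auto
      then show False using x(2) by simp
    qed
  qed
qed

end
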